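(* Let $H$ be a triangle-free graph. Then the problem $\textsc{LHom}(H)$ can be solved in polynomial time on input graphs of diameter at most $2$.
   Context: All graphs are finite and simple (no loops). For a fixed graph $H$, in the list homomorphism problem $\textsc{LHom}(H)$ the input is a graph $G$ together with lists $L: V(G)\to 2^{V(H)}$, and the question is whether there is a mapping $\varphi: V(G)\to V(H)$ with $\varphi(v)\in L(v)$ for all $v\in V(G)$ and $\varphi(u)\varphi(v)\in E(H)$ for every edge $uv\in E(G)$. The diameter of $G$ is the maximum over pairs of vertices of their distance in $G$. *)

theory Defs
  imports
    "Graph_Theory.Graph_Theory"
    "HOL-Library.Extended_Nat"
    "HOL-Computational_Algebra.Polynomial"
begin

text \<open>
  Finite simple graphs are modelled by the locale \<open>pair_graph\<close>: a finite vertex set and a finite,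
  symmetric, loop-free set of arcs, the undirected edge \<open>uv\<close> being the pair of arcs
  \<open>(u, v)\<close> and \<open>(v, u)\<close>.
\<close>

definition triangle_free :: "'a pair_pre_digraph \<Rightarrow> bool" where
  "triangle_free H \<longleftrightarrow>
     \<not> (\<exists>a b c. (a, b) \<in> parcs H \<and> (b, c) \<in> parcs H \<and> (a, c) \<in> parcs H)"

text \<open>The distance of two vertices in different components is \<open>\<infinity>\<close>, and so is then the diameter.\<close>

definition graph_distance :: "'a pair_pre_digraph \<Rightarrow> 'a \<Rightarrow> 'a \<Rightarrow> enat" where
  "graph_distance G u v = (INF p \<in> {p. pre_digraph.awalk (with_proj G) u p v}. enat (length p))"

definition graph_diameter :: "'a pair_pre_digraph \<Rightarrow> enat" where
  "graph_diameter G = (SUP (u, v) \<in> pverts G \<times> pverts G. graph_distance G u v)"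

definition list_homomorphism ::
  "'b pair_pre_digraph \<Rightarrow> 'a pair_pre_digraph \<Rightarrow> ('b \<Rightarrow> 'a set) \<Rightarrow> ('b \<Rightarrow> 'a) \<Rightarrow> bool" where
  "list_homomorphism G H L \<phi> \<longleftrightarrow>
     (\<forall>v \<in> pverts G. \<phi> v \<in> pverts H \<and> \<phi> v \<in> L v) \<and>
     (\<forall>(u, v) \<in> parcs G. (\<phi> u, \<phi> v) \<in> parcs H)"

text \<open>
  As inputs to an algorithm, graphs have an initial segment of the natural numbers as vertex set.
\<close>

type_synonym 'a lhom_input = "nat pair_pre_digraph \<times> (nat \<Rightarrow> 'a set)"

definition lhom_instances :: "'a pair_pre_digraph \<Rightarrow> 'a lhom_input set" where
  "lhom_instances H =
     {(G, L). pair_graph G \<and> pverts G = {..<card (pverts G)} \<and> (\<forall>v \<in> pverts G. L v \<subseteq> pverts H)}"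

definition lhom_yes :: "'a pair_pre_digraph \<Rightarrow> 'a lhom_input \<Rightarrow> bool" where
  "lhom_yes H = (\<lambda>(G, L). \<exists>\<phi>. list_homomorphism G H L \<phi>)"

text \<open>
  The input string consists of the number of vertices of \<open>G\<close> in unary, a separator, the rows of the
  adjacency matrix of \<open>G\<close>, and, for each vertex of \<open>G\<close>, the characteristic vector of its list
  with respect to an enumeration \<open>hs\<close> of the vertices of \<open>H\<close>.
\<close>

definition lhom_encode :: "'a list \<Rightarrow> 'a lhom_input \<Rightarrow> bool list" where
  "lhom_encode hs = (\<lambda>(G, L). let n = card (pverts G) in
     replicate n True @ [False] @
     [(u, v) \<in> parcs G. u \<leftarrow> [0..<n], v \<leftarrow> [0..<n]] @
     [h \<in> L v. v \<leftarrow> [0..<n], h \<leftarrow> hs])"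

text \<open>
  Polynomial time is defined by random access machines with registers and an indirectly addressed
  memory, both holding natural numbers. Every instruction costs one step. As there is no
  multiplication or shift, numbers grow by at most one bit per step, so that this unit cost measure
  is polynomially equivalent to the logarithmic one and to time on Turing machines.
\<close>

datatype instr =
    Const nat nat        \<comment> \<open>\<open>R a := k\<close>\<close>
  | Plus nat nat nat     \<comment> \<open>\<open>R a := R b + R c\<close>\<close>
  | Minus nat nat nat    \<comment> \<open>\<open>R a := R b - R c\<close>, truncated at 0\<close>
  | Load nat nat         \<comment> \<open>\<open>R a := M (R b)\<close>\<close>
  | Store nat nat        \<comment> \<open>\<open>M (R a) := R b\<close>\<close>
  | Jump nat             \<comment> \<open>absolute jump\<close>
  | JumpZero nat nat     \<comment> \<open>jump to the second argument if \<open>R a = 0\<close>\<close>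

type_synonym ram_program = "instr list"

record ram_config =
  pc :: nat
  regs :: "nat \<Rightarrow> nat"
  mem :: "nat \<Rightarrow> nat"

fun exec_instr :: "instr \<Rightarrow> ram_config \<Rightarrow> ram_config" where
  "exec_instr (Const a k) s = s\<lparr>pc := pc s + 1, regs := (regs s)(a := k)\<rparr>"
| "exec_instr (Plus a b c) s = s\<lparr>pc := pc s + 1, regs := (regs s)(a := regs s b + regs s c)\<rparr>"
| "exec_instr (Minus a b c) s = s\<lparr>pc := pc s + 1, regs := (regs s)(a := regs s b - regs s c)\<rparr>"
| "exec_instr (Load a b) s = s\<lparr>pc := pc s + 1, regs := (regs s)(a := mem s (regs s b))\<rparr>"
| "exec_instr (Store a b) s = s\<lparr>pc := pc s + 1, mem := (mem s)(regs s a := regs s b)\<rparr>"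
| "exec_instr (Jump l) s = s\<lparr>pc := l\<rparr>"
| "exec_instr (JumpZero a l) s = s\<lparr>pc := (if regs s a = 0 then l else pc s + 1)\<rparr>"

definition halted :: "ram_program \<Rightarrow> ram_config \<Rightarrow> bool" where
  "halted P s \<longleftrightarrow> length P \<le> pc s"

definition ram_step :: "ram_program \<Rightarrow> ram_config \<Rightarrow> ram_config" where
  "ram_step P s = (if halted P s then s else exec_instr (P ! pc s) s)"

definition ram_run :: "ram_program \<Rightarrow> nat \<Rightarrow> ram_config \<Rightarrow> ram_config" where
  "ram_run P t = ram_step P ^^ t"

text \<open>The machine starts with the input bits in memory and their number in register 0.\<close>

definition ram_init :: "bool list \<Rightarrow> ram_config" where
  "ram_init x =
     \<lparr>pc = 0,
      regs = (\<lambda>_. 0)(0 := length x),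
      mem = (\<lambda>i. if i < length x then of_bool (x ! i) else 0)\<rparr>"

text \<open>
  The decision problem \<open>Q\<close>, with inputs encoded by \<open>enc\<close>, is solved in polynomial time on the
  inputs in \<open>D\<close>. Halted configurations are fixed points of \<open>ram_step\<close>, so running for a given
  number of steps and being halted means halting within that number of steps; the answer is the
  final content of register 0.
\<close>

definition poly_time_solvable_on :: "('i \<Rightarrow> bool list) \<Rightarrow> 'i set \<Rightarrow> ('i \<Rightarrow> bool) \<Rightarrow> bool" where
  "poly_time_solvable_on enc D Q \<longleftrightarrow>
     (\<exists>(P :: ram_program) (q :: nat poly). \<forall>x \<in> D.
        let s = ram_run P (poly q (length (enc x))) (ram_init (enc x))
        in halted P s \<and> regs s 0 = of_bool (Q x))"

end

theory Submission
  imports Defs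
begin

text \<open>
  Let \<open>\<phi> : G \<rightarrow> H\<close> be a homomorphism, where \<open>G\<close> has diameter at most 2 and \<open>H\<close> is triangle-free.
  If \<open>\<phi> u\<close> and \<open>\<phi> v\<close> are adjacent then so are \<open>u\<close> and \<open>v\<close>, since the image of a common neighbour
  of \<open>u\<close> and \<open>v\<close> would complete a triangle. Hence vertices with the same image have the same
  neighbours. So choose one preimage \<open>r h\<close> of each \<open>h\<close> in the image: every map that sends each \<open>u\<close>
  to some \<open>h \<in> L u\<close> for which \<open>u\<close> and \<open>r h\<close> have the same neighbours is a homomorphism. The
  existence of a suitable \<open>r\<close> is a first-order property of the input with a number of quantifiers
  depending only on \<open>H\<close>, and such properties are decided in polynomial time by nested loops.
\<close>

section \<open>Homomorphisms from graphs of diameter two\<close>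

lemma graph_distance_le_graph_diameter:
  assumes "u \<in> pverts G" "v \<in> pverts G"
  shows "graph_distance G u v \<le> graph_diameter G"
  unfolding graph_diameter_def using assms by (intro SUP_upper2[of "(u, v)"]) auto

lemma graph_distance_le_imp_awalk:
  assumes "graph_distance G u v \<le> enat k"
  obtains p where "pre_digraph.awalk (with_proj G) u p v" "length p \<le> k"
proof -
  have "graph_distance G u v < enat (Suc k)"
    using assms by (rule le_less_trans) simp
  then show thesis
    using that by (auto simp: graph_distance_def INF_less_iff)
qed

lemma (in pair_wf_digraph) common_neighbour_if_diameter_le_2:
  assumes "graph_diameter G \<le> 2" "u \<in> pverts G" "v \<in> pverts G" "u \<noteq> v" "(u, v) \<notin> parcs G"
  obtains w where "(u, w) \<in> parcs G" "(w, v) \<in> parcs G"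
proof -
  have "graph_distance G u v \<le> enat 2"
    using graph_distance_le_graph_diameter[OF assms(2,3)] assms(1)
    by (simp add: numeral_eq_enat)
  then obtain p where p: "awalk u p v" "length p \<le> 2"
    by (rule graph_distance_le_imp_awalk)
  then consider "p = []" | e where "p = [e]" | e f where "p = [e, f]"
    by (auto simp: le_Suc_eq length_Suc_conv numeral_2_eq_2)
  then show thesis
    using p(1) assms(4,5) that by cases (auto simp: awalk_simps)
qed

lemma (in pair_wf_digraph) homomorphism_adjacent_iff:
  assumes "triangle_free H" "graph_diameter G \<le> 2"
    and hom: "list_homomorphism G H L \<phi>" and vertices: "u \<in> pverts G" "v \<in> pverts G"
  shows "(\<phi> u, \<phi> v) \<in> parcs H \<longleftrightarrow> (u, v) \<in> parcs G"
proof
  assume image_adjacent: "(\<phi> u, \<phi> v) \<in> parcs H"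
  then have "u \<noteq> v"
    using \<open>triangle_free H\<close> by (auto simp: triangle_free_def)
  show "(u, v) \<in> parcs G"
  proof (rule ccontr)
    assume "(u, v) \<notin> parcs G"
    with \<open>graph_diameter G \<le> 2\<close> vertices \<open>u \<noteq> v\<close>
    obtain w where "(u, w) \<in> parcs G" "(w, v) \<in> parcs G"
      by (rule common_neighbour_if_diameter_le_2)
    then have "(\<phi> u, \<phi> w) \<in> parcs H" "(\<phi> w, \<phi> v) \<in> parcs H"
      using hom by (auto simp: list_homomorphism_def)
    then show False
      using image_adjacent \<open>triangle_free H\<close> by (auto simp: triangle_free_def)
  qed
qed (use hom in \<open>auto simp: list_homomorphism_def\<close>)

definition twins :: "'b pair_pre_digraph \<Rightarrow> 'b \<Rightarrow> 'b \<Rightarrow> bool" where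
  "twins G u v \<longleftrightarrow> (\<forall>w \<in> pverts G. (u, w) \<in> parcs G \<longleftrightarrow> (v, w) \<in> parcs G)"

text \<open>
  A value \<open>r h\<close> outside of \<open>G\<close> counts as an isolated vertex and serves for those \<open>h\<close> that are not in
  the image.
\<close>

definition representatives ::
  "'b pair_pre_digraph \<Rightarrow> 'a pair_pre_digraph \<Rightarrow> ('b \<Rightarrow> 'a set) \<Rightarrow> ('a \<Rightarrow> 'b) \<Rightarrow> bool" where
  "representatives G H L r \<longleftrightarrow>
     (\<forall>h \<in> pverts H. \<forall>h' \<in> pverts H. (r h, r h') \<in> parcs G \<longrightarrow> (h, h') \<in> parcs H) \<and>
     (\<forall>u \<in> pverts G. \<exists>h \<in> pverts H. h \<in> L u \<and> twins G u (r h))"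

lemma representatives_cong:
  assumes "\<And>h. h \<in> pverts H \<Longrightarrow> r h = r' h"
  shows "representatives G H L r \<longleftrightarrow> representatives G H L r'"
  unfolding representatives_def using assms by (simp cong: ball_cong bex_cong)

lemma (in pair_sym_digraph) representatives_imp_homomorphism:
  assumes "representatives G H L r"
  obtains \<phi> where "list_homomorphism G H L \<phi>"
proof -
  obtain \<phi> where \<phi>: "\<phi> u \<in> pverts H" "\<phi> u \<in> L u" "twins G u (r (\<phi> u))" if "u \<in> pverts G" for u
    using assms unfolding representatives_def by metis
  have "(\<phi> u, \<phi> v) \<in> parcs H" if uv: "(u, v) \<in> parcs G" for u v
  proof -
    have vertices: "u \<in> pverts G" "v \<in> pverts G"
      using in_arcsD1[OF uv] in_arcsD2[OF uv] .
    have "(r (\<phi> u), v) \<in> parcs G"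
      using uv \<phi>(3)[OF vertices(1)] vertices by (simp add: twins_def)
    then have "(v, r (\<phi> u)) \<in> parcs G" "r (\<phi> u) \<in> pverts G"
      by (auto intro: arcs_symmetric in_arcsD1)
    then have "(r (\<phi> v), r (\<phi> u)) \<in> parcs G"
      using \<phi>(3)[OF vertices(2)] by (simp add: twins_def)
    then have "(r (\<phi> u), r (\<phi> v)) \<in> parcs G"
      by (rule arcs_symmetric)
    then show ?thesis
      using assms \<phi>(1) vertices by (auto simp: representatives_def)
  qed
  with \<phi>(1,2) have "list_homomorphism G H L \<phi>"
    by (auto simp: list_homomorphism_def)
  then show thesis by (rule that)
qed

lemma (in pair_wf_digraph) homomorphism_imp_representatives:
  assumes "triangle_free H" "graph_diameter G \<le> 2"
    and hom: "list_homomorphism G H L \<phi>"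
    and Z: "pverts G \<subset> Z"
  obtains r where "\<And>h. r h \<in> Z" "representatives G H L r"
proof -
  note adjacent_iff = homomorphism_adjacent_iff[OF assms(1-3)]
  obtain z where z: "z \<in> Z" "z \<notin> pverts G" using Z by blast
  define r where "r h = (if h \<in> \<phi> ` pverts G then inv_into (pverts G) \<phi> h else z)" for h
  have r_preimage: "r (\<phi> u) \<in> pverts G" "\<phi> (r (\<phi> u)) = \<phi> u" if "u \<in> pverts G" for u
    using that by (auto simp: r_def inv_into_into f_inv_into_f)
  have r_in_image: "\<phi> (r h) = h" if "r h \<in> pverts G" for h
    using that z(2) by (auto simp: r_def f_inv_into_f split: if_splits)
  have "(h, h') \<in> parcs H" if arc: "(r h, r h') \<in> parcs G" for h h'
    using arc in_arcsD1[OF arc] in_arcsD2[OF arc]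
    by (simp add: r_in_image flip: adjacent_iff)
  moreover have "twins G u (r (\<phi> u))" if "u \<in> pverts G" for u
    using that r_preimage by (simp add: twins_def flip: adjacent_iff)
  ultimately have "representatives G H L r"
    using hom by (auto simp: representatives_def list_homomorphism_def)
  moreover have "r h \<in> Z" for h
    using r_preimage z(1) Z by (cases "h \<in> \<phi> ` pverts G") (auto simp: r_def)
  ultimately show thesis using that by blast
qed

lemma (in pair_sym_digraph) homomorphism_iff_representatives:
  assumes "triangle_free H" "graph_diameter G \<le> 2" "pverts G \<subset> Z"
  shows "(\<exists>\<phi>. list_homomorphism G H L \<phi>) \<longleftrightarrow>
    (\<exists>r. (\<forall>h\<in>pverts H. r h \<in> Z) \<and> representatives G H L r)"
  using representatives_imp_homomorphism homomorphism_imp_representatives[OF assms(1,2) _ assms(3)]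
  by metis

section \<open>Arithmetic terms with bounded sums and their compilation\<close>

datatype arith_op = Add | Sub

fun apply_op :: "arith_op \<Rightarrow> nat \<Rightarrow> nat \<Rightarrow> nat" where
  "apply_op Add = (+)"
| "apply_op Sub = (-)"

fun op_instr :: "arith_op \<Rightarrow> nat \<Rightarrow> nat \<Rightarrow> nat \<Rightarrow> instr" where
  "op_instr Add = Plus"
| "op_instr Sub = Minus"

datatype 'v trm =
    Cst nat
  | Var 'v
  | BinOp arith_op "'v trm" "'v trm"
  | Cell "'v trm"
  | Sum 'v "'v trm"

fun eval :: "(nat \<Rightarrow> nat) \<Rightarrow> nat \<Rightarrow> ('v \<Rightarrow> nat) \<Rightarrow> 'v trm \<Rightarrow> nat" where
  "eval M N \<rho> (Cst k) = k"
| "eval M N \<rho> (Var x) = \<rho> x"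
| "eval M N \<rho> (BinOp f a b) = apply_op f (eval M N \<rho> a) (eval M N \<rho> b)"
| "eval M N \<rho> (Cell a) = M (eval M N \<rho> a)"
| "eval M N \<rho> (Sum x a) = (\<Sum>i<N. eval M N (\<rho>(x := i)) a)"

lemma eval_fun_upd_fresh:
  assumes "x \<notin> set_trm t"
  shows "eval M N (\<rho>(x := i)) t = eval M N \<rho> t"
  using assms by (induction t arbitrary: \<rho>) (simp_all add: fun_upd_twist)

text \<open>
  Adds up, in register \<open>d\<close>, the values that the code \<open>c\<close> for the body of the loop leaves in register
  \<open>d + 3\<close> while register \<open>d + 1\<close> counts down from the content of register \<open>0\<close>.
\<close>

definition sum_loop :: "nat \<Rightarrow> nat \<Rightarrow> instr list \<Rightarrow> instr list" where
  "sum_loop d p c =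
     [Const d 0, Plus (d + 1) d 0, Const (d + 2) 1,
      JumpZero (d + 1) (p + length c + 7),
      Minus (d + 1) (d + 1) (d + 2)] @
     c @
     [Plus d d (d + 3), Jump (p + 3)]"

text \<open>
  The code of a term, placed at address \<open>p\<close>, leaves the value in register \<open>d\<close>. The variable \<open>x\<close> is
  held in register \<open>vs x\<close>, the bound \<open>N\<close> of the sums in register \<open>0\<close>.
\<close>

fun compile :: "('v \<Rightarrow> nat) \<Rightarrow> nat \<Rightarrow> nat \<Rightarrow> 'v trm \<Rightarrow> instr list" where
  "compile vs d p (Cst k) = [Const d k]"
| "compile vs d p (Var x) = [Const d 0, Plus d d (vs x)]"
| "compile vs d p (BinOp f a b) =
     (let c = compile vs d p a
      in c @ compile vs (d + 1) (p + length c) b @ [op_instr f d d (d + 1)])"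
| "compile vs d p (Cell a) = compile vs d p a @ [Load d d]"
| "compile vs d p (Sum x a) = sum_loop d p (compile (vs(x := d + 1)) (d + 3) (p + 5) a)"

fun time_poly :: "'v trm \<Rightarrow> nat poly" where
  "time_poly (Cst k) = 1"
| "time_poly (Var x) = 2"
| "time_poly (BinOp f a b) = time_poly a + time_poly b + 1"
| "time_poly (Cell a) = time_poly a + 1"
| "time_poly (Sum x a) = [:0, 1:] * (time_poly a + 4) + 4"

fun code_at :: "ram_program \<Rightarrow> nat \<Rightarrow> instr list \<Rightarrow> bool" where
  "code_at P p [] \<longleftrightarrow> True"
| "code_at P p (i # c) \<longleftrightarrow> p < length P \<and> P ! p = i \<and> code_at P (p + 1) c"

lemma code_at_append:
  "code_at P p (c @ c') \<longleftrightarrow> code_at P p c \<and> code_at P (p + length c) c'"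
  by (induction c arbitrary: p) auto

lemma code_at_self: "code_at (pre @ c @ post) (length pre) c"
proof (induction c arbitrary: pre)
  case (Cons i c)
  then show ?case using Cons.IH[of "pre @ [i]"] by simp
qed simp

lemma ram_run_add: "ram_run P (t + t') s = ram_run P t' (ram_run P t s)"
  by (simp add: ram_run_def add.commute[of t] funpow_add)

lemma ram_run_0 [simp]: "ram_run P 0 s = s"
  by (simp add: ram_run_def)

lemma ram_run_Suc:
  assumes "pc s < length P"
  shows "ram_run P (Suc t) s = ram_run P t (exec_instr (P ! pc s) s)"
  using assms by (simp add: ram_run_def ram_step_def halted_def funpow_Suc_right del: funpow.simps)

lemma exec_op_instr [simp]:
  "exec_instr (op_instr f a b c) s =
     s\<lparr>pc := pc s + 1, regs := (regs s)(a := apply_op f (regs s b) (regs s c))\<rparr>"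
  by (cases f) simp_all

definition unchanged_below :: "nat \<Rightarrow> ram_config \<Rightarrow> ram_config \<Rightarrow> bool" where
  "unchanged_below d s s' \<longleftrightarrow> (\<forall>r<d. regs s' r = regs s r) \<and> mem s' = mem s"

lemma unchanged_below_trans:
  assumes "unchanged_below d s s'" "unchanged_below d' s' s''" "d \<le> d'"
  shows "unchanged_below d s s''"
  using assms by (simp add: unchanged_below_def)

definition evaluates_to :: "ram_program \<Rightarrow> nat \<Rightarrow> ram_config \<Rightarrow> nat \<Rightarrow> nat \<Rightarrow> nat \<Rightarrow> bool" where
  "evaluates_to P t s q d a \<longleftrightarrow>
     (let s' = ram_run P t s in pc s' = q \<and> regs s' d = a \<and> unchanged_below d s s')"

lemma evaluates_toE:
  assumes "evaluates_to P t s q d a"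
  obtains s' where "ram_run P t s = s'" "pc s' = q" "regs s' d = a" "unchanged_below d s s'"
  using assms by (auto simp: evaluates_to_def Let_def)

lemma evaluates_to_run:
  assumes "ram_run P t s = s'" "unchanged_below d s s'" "evaluates_to P t' s' q d a"
  shows "evaluates_to P (t + t') s q d a"
  using assms unchanged_below_trans by (auto simp: evaluates_to_def Let_def ram_run_add)

lemma evaluates_to_op:
  assumes eval_a: "evaluates_to P t s q d a"
    and eval_b: "\<And>s'. pc s' = q \<Longrightarrow> unchanged_below d s s' \<Longrightarrow> evaluates_to P t' s' q' (d + 1) b"
    and code: "code_at P q' [op_instr f d d (d + 1)]"
  shows "evaluates_to P (t + t' + 1) s (q' + 1) d (apply_op f a b)"
proof -
  obtain s1 where s1: "ram_run P t s = s1" "pc s1 = q" "regs s1 d = a" "unchanged_below d s s1"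
    using eval_a by (rule evaluates_toE)
  obtain s2 where s2: "ram_run P t' s1 = s2" "pc s2 = q'" "regs s2 (d + 1) = b"
      "unchanged_below (d + 1) s1 s2"
    using eval_b[OF s1(2,4)] by (rule evaluates_toE)
  have "ram_run P (t + t' + 1) s = ram_run P 1 s2"
    by (simp only: ram_run_add s1(1) s2(1))
  also have "\<dots> = exec_instr (op_instr f d d (d + 1)) s2"
    using code s2(2) by (simp add: ram_run_Suc)
  finally show ?thesis
    using s1 s2 by (simp add: evaluates_to_def unchanged_below_def)
qed

lemma evaluates_to_load:
  assumes eval_a: "evaluates_to P t s q d a" and code: "code_at P q [Load d d]"
  shows "evaluates_to P (t + 1) s (q + 1) d (mem s a)"
proof -
  obtain s1 where s1: "ram_run P t s = s1" "pc s1 = q" "regs s1 d = a" "unchanged_below d s s1"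
    using eval_a by (rule evaluates_toE)
  have "ram_run P (t + 1) s = ram_run P 1 s1"
    by (simp only: ram_run_add s1(1))
  also have "\<dots> = exec_instr (Load d d) s1"
    using code s1(2) by (simp add: ram_run_Suc)
  finally show ?thesis
    using s1 by (simp add: evaluates_to_def unchanged_below_def)
qed

lemma length_sum_loop [simp]: "length (sum_loop d p c) = length c + 7"
  by (simp add: sum_loop_def)

lemma code_at_sum_loopD:
  assumes "code_at P p (sum_loop d p c)"
  shows "code_at P p [Const d 0, Plus (d + 1) d 0, Const (d + 2) 1]"
    and "code_at P (p + 3) [JumpZero (d + 1) (p + length c + 7), Minus (d + 1) (d + 1) (d + 2)]"
    and "code_at P (p + 5) c"
    and "code_at P (p + 5 + length c) [Plus d d (d + 3), Jump (p + 3)]"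
  using assms by (simp_all add: sum_loop_def code_at_append eval_nat_numeral)

lemma sum_loop_iteration:
  assumes code: "code_at P p (sum_loop d p c)"
    and body: "\<And>s'. pc s' = p + 5 \<Longrightarrow> unchanged_below d s s' \<Longrightarrow>
      evaluates_to P t s' (p + 5 + length c) (d + 3) (f (regs s' (d + 1)))"
    and s: "pc s = p + 3" "regs s (d + 1) = Suc n" "regs s (d + 2) = 1"
  obtains s' where "ram_run P (t + 4) s = s'" "pc s' = p + 3" "regs s' d = regs s d + f n"
    "regs s' (d + 1) = n" "regs s' (d + 2) = 1" "unchanged_below d s s'"
proof -
  define s1 where "s1 = s\<lparr>pc := p + 5, regs := (regs s)(d + 1 := n)\<rparr>"
  have run1: "ram_run P 2 s = s1"
    using code_at_sum_loopD(2)[OF code] s by (simp add: s1_def numeral_2_eq_2 ram_run_Suc)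
  have "unchanged_below d s s1"
    by (simp add: s1_def unchanged_below_def)
  then have "evaluates_to P t s1 (p + 5 + length c) (d + 3) (f n)"
    using body[of s1] by (simp add: s1_def)
  then obtain s2 where s2: "ram_run P t s1 = s2" "pc s2 = p + 5 + length c"
      "regs s2 (d + 3) = f n" "unchanged_below (d + 3) s1 s2"
    by (rule evaluates_toE)
  define s3 where "s3 = s2\<lparr>pc := p + 3, regs := (regs s2)(d := regs s2 d + f n)\<rparr>"
  have run3: "ram_run P 2 s2 = s3"
    using code_at_sum_loopD(4)[OF code] s2(2,3)
    by (simp add: s3_def numeral_2_eq_2 ram_run_Suc)
  show thesis
  proof (rule that)
    have "ram_run P (2 + t + 2) s = s3"
      by (simp only: ram_run_add run1 s2(1) run3)
    then show "ram_run P (t + 4) s = s3" by (simp add: eval_nat_numeral)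
  qed (use s2(4) s in \<open>simp_all add: s1_def s3_def unchanged_below_def\<close>)
qed

lemma sum_loop_iterations:
  assumes code: "code_at P p (sum_loop d p c)"
    and body: "\<And>s'. pc s' = p + 5 \<Longrightarrow> unchanged_below d s s' \<Longrightarrow>
      evaluates_to P t s' (p + 5 + length c) (d + 3) (f (regs s' (d + 1)))"
    and "pc s = p + 3" "regs s (d + 1) = n" "regs s (d + 2) = 1"
  shows "evaluates_to P (n * (t + 4) + 1) s (p + length c + 7) d (regs s d + (\<Sum>i<n. f i))"
  using assms(2-)
proof (induction n arbitrary: s)
  case 0
  then show ?case
    using code_at_sum_loopD(2)[OF code]
    by (simp add: evaluates_to_def unchanged_below_def ram_run_Suc)
next
  case (Suc n)
  obtain s1 where run: "ram_run P (t + 4) s = s1" and below: "unchanged_below d s s1"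
    and s1: "pc s1 = p + 3" "regs s1 d = regs s d + f n" "regs s1 (d + 1) = n"
      "regs s1 (d + 2) = 1"
    using sum_loop_iteration[OF code Suc.prems] by blast
  have "evaluates_to P (n * (t + 4) + 1) s1 (p + length c + 7) d (regs s1 d + (\<Sum>i<n. f i))"
  proof (rule Suc.IH)
    show "evaluates_to P t s' (p + 5 + length c) (d + 3) (f (regs s' (d + 1)))"
      if "pc s' = p + 5" "unchanged_below d s1 s'" for s'
      using Suc.prems(1) that unchanged_below_trans[OF below] by blast
  qed (use s1 in simp_all)
  then have "evaluates_to P (t + 4 + (n * (t + 4) + 1)) s (p + length c + 7) d
      (regs s1 d + (\<Sum>i<n. f i))"
    by (rule evaluates_to_run[OF run below])
  moreover have "t + 4 + (n * (t + 4) + 1) = Suc n * (t + 4) + 1" by simp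
  ultimately show ?case by (simp only: s1(2)) (simp add: ac_simps)
qed

lemma sum_loop_correct:
  assumes code: "code_at P p (sum_loop d p c)"
    and body: "\<And>s'. pc s' = p + 5 \<Longrightarrow> unchanged_below d s s' \<Longrightarrow>
      evaluates_to P t s' (p + 5 + length c) (d + 3) (f (regs s' (d + 1)))"
    and "pc s = p" "0 < d"
  shows "evaluates_to P (regs s 0 * (t + 4) + 4) s (p + length c + 7) d (\<Sum>i<regs s 0. f i)"
proof -
  let ?n = "regs s 0"
  define s1 where "s1 = s\<lparr>pc := p + 3, regs := (regs s)(d := 0, d + 1 := ?n, d + 2 := 1)\<rparr>"
  have run1: "ram_run P 3 s = s1"
    using code_at_sum_loopD(1)[OF code] assms(3,4)
    by (simp add: s1_def numeral_3_eq_3 ram_run_Suc)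
  have below1: "unchanged_below d s s1"
    by (simp add: s1_def unchanged_below_def)
  have "evaluates_to P (?n * (t + 4) + 1) s1 (p + length c + 7) d (regs s1 d + (\<Sum>i<?n. f i))"
  proof (rule sum_loop_iterations[OF code])
    show "evaluates_to P t s' (p + 5 + length c) (d + 3) (f (regs s' (d + 1)))"
      if "pc s' = p + 5" "unchanged_below d s1 s'" for s'
      using body that unchanged_below_trans[OF below1] by blast
  qed (simp_all add: s1_def)
  then have "evaluates_to P (3 + (?n * (t + 4) + 1)) s (p + length c + 7) d
      (regs s1 d + (\<Sum>i<?n. f i))"
    by (rule evaluates_to_run[OF run1 below1])
  then show ?thesis by (simp add: s1_def add.commute)
qed

definition compiles_correctly :: "ram_program \<Rightarrow> 'v trm \<Rightarrow> bool" where
  "compiles_correctly P t \<longleftrightarrow>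
     (\<forall>vs d p s. code_at P p (compile vs d p t) \<longrightarrow> pc s = p \<longrightarrow> (\<forall>x. vs x < d) \<longrightarrow> 0 < d \<longrightarrow>
        evaluates_to P (poly (time_poly t) (regs s 0)) s (p + length (compile vs d p t)) d
          (eval (mem s) (regs s 0) (\<lambda>x. regs s (vs x)) t))"

lemma compiles_correctly_BinOp:
  fixes a b :: "'v trm"
  assumes correct_a: "compiles_correctly P a" and correct_b: "compiles_correctly P b"
  shows "compiles_correctly P (BinOp f a b)"
  unfolding compiles_correctly_def
proof (intro allI impI)
  fix vs :: "'v \<Rightarrow> nat" and d p and s :: ram_config
  let ?q = "p + length (compile vs d p a)"
  let ?q' = "?q + length (compile vs (d + 1) ?q b)"
  let ?t = "\<lambda>t :: 'v trm. poly (time_poly t) (regs s 0)"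
  let ?eval = "eval (mem s) (regs s 0) (\<lambda>x. regs s (vs x))"
  assume "code_at P p (compile vs d p (BinOp f a b))" "pc s = p"
    and vs: "\<forall>x. vs x < d" and "0 < d"
  then have code: "code_at P p (compile vs d p a)" "code_at P ?q (compile vs (d + 1) ?q b)"
      "code_at P ?q' [op_instr f d d (d + 1)]"
    by (simp_all add: Let_def code_at_append)
  have "evaluates_to P (?t a) s ?q d (?eval a)"
    using correct_a code(1) \<open>pc s = p\<close> vs \<open>0 < d\<close> by (simp add: compiles_correctly_def)
  moreover have "evaluates_to P (?t b) s' ?q' (d + 1) (?eval b)"
    if "pc s' = ?q" and below: "unchanged_below d s s'" for s'
  proof -
    have "regs s' 0 = regs s 0" "mem s' = mem s" "(\<lambda>x. regs s' (vs x)) = (\<lambda>x. regs s (vs x))"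
      using below vs \<open>0 < d\<close> by (auto simp: unchanged_below_def)
    moreover have "\<forall>x. vs x < d + 1" using vs by (simp add: less_SucI)
    ultimately show ?thesis
      using correct_b code(2) that(1) unfolding compiles_correctly_def
      by (metis zero_less_Suc Suc_eq_plus1)
  qed
  ultimately have "evaluates_to P (?t a + ?t b + 1) s (?q' + 1) d
      (apply_op f (?eval a) (?eval b))"
    using code(3) by (rule evaluates_to_op)
  then show "evaluates_to P (poly (time_poly (BinOp f a b)) (regs s 0)) s
      (p + length (compile vs d p (BinOp f a b))) d (?eval (BinOp f a b))"
    by (simp add: Let_def poly_add add.assoc)
qed

lemma compiles_correctly_Cell:
  fixes a :: "'v trm"
  assumes "compiles_correctly P a"
  shows "compiles_correctly P (Cell a)"
  unfolding compiles_correctly_def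
proof (intro allI impI)
  fix vs :: "'v \<Rightarrow> nat" and d p and s :: ram_config
  let ?q = "p + length (compile vs d p a)"
  let ?eval = "eval (mem s) (regs s 0) (\<lambda>x. regs s (vs x))"
  assume "code_at P p (compile vs d p (Cell a))" "pc s = p" "\<forall>x. vs x < d" "0 < d"
  moreover from this have "code_at P ?q [Load d d]"
    by (simp add: code_at_append)
  ultimately have "evaluates_to P (poly (time_poly a) (regs s 0) + 1) s (?q + 1) d
      (mem s (?eval a))"
    using assms by (intro evaluates_to_load) (simp_all add: code_at_append compiles_correctly_def)
  then show "evaluates_to P (poly (time_poly (Cell a)) (regs s 0)) s
      (p + length (compile vs d p (Cell a))) d (?eval (Cell a))"
    by (simp add: poly_add)
qed

lemma compiles_correctly_Sum:
  fixes a :: "'v trm"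
  assumes correct_a: "compiles_correctly P a"
  shows "compiles_correctly P (Sum x a)"
  unfolding compiles_correctly_def
proof (intro allI impI)
  fix vs :: "'v \<Rightarrow> nat" and d p and s :: ram_config
  define vs' where "vs' = vs(x := d + 1)"
  let ?c = "compile vs' (d + 3) (p + 5) a"
  let ?N = "regs s 0" and ?t = "poly (time_poly a) (regs s 0)"
  assume "code_at P p (compile vs d p (Sum x a))" "pc s = p"
    and vs: "\<forall>x. vs x < d" and "0 < d"
  then have code: "code_at P p (sum_loop d p ?c)" by (simp add: vs'_def)
  have "evaluates_to P ?t s' (p + 5 + length ?c) (d + 3)
      (eval (mem s) ?N ((\<lambda>y. regs s (vs y))(x := regs s' (d + 1))) a)"
    if "pc s' = p + 5" and below: "unchanged_below d s s'" for s'
  proof -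
    have "regs s' 0 = ?N" "mem s' = mem s"
        "(\<lambda>y. regs s' (vs' y)) = (\<lambda>y. regs s (vs y))(x := regs s' (d + 1))"
      using below vs \<open>0 < d\<close> by (auto simp: unchanged_below_def vs'_def)
    moreover have "vs' y < d + 3" for y
      using vs[rule_format, of y] by (simp add: vs'_def)
    ultimately show ?thesis
      using correct_a code_at_sum_loopD(3)[OF code] that(1) unfolding compiles_correctly_def
      by (metis add_gr_0 zero_less_numeral)
  qed
  then have "evaluates_to P (?N * (?t + 4) + 4) s (p + length ?c + 7) d
      (\<Sum>i<?N. eval (mem s) ?N ((\<lambda>y. regs s (vs y))(x := i)) a)"
    using \<open>pc s = p\<close> \<open>0 < d\<close> by (rule sum_loop_correct[OF code])
  moreover have "poly (time_poly (Sum x a)) ?N = ?N * (?t + 4) + 4"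
    by simp
  moreover have "length (compile vs d p (Sum x a)) = length ?c + 7"
    by (simp add: vs'_def)
  ultimately show "evaluates_to P (poly (time_poly (Sum x a)) ?N) s
      (p + length (compile vs d p (Sum x a))) d
      (eval (mem s) ?N (\<lambda>x. regs s (vs x)) (Sum x a))"
    by (simp only: eval.simps add.assoc)
qed

lemma compiles_correctly: "compiles_correctly P t"
proof (induction t)
  case (Cst k)
  then show ?case
    by (simp add: compiles_correctly_def evaluates_to_def unchanged_below_def ram_run_Suc)
next
  case (Var x)
  then show ?case
    by (simp add: compiles_correctly_def evaluates_to_def unchanged_below_def ram_run_Suc
      numeral_2_eq_2 less_imp_neq)
qed (simp_all add: compiles_correctly_BinOp compiles_correctly_Cell compiles_correctly_Sum)

lemma compile_correct:
  assumes "code_at P p (compile vs d p t)" "pc s = p" "\<And>x. vs x < d" "0 < d"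
  shows "evaluates_to P (poly (time_poly t) (regs s 0)) s (p + length (compile vs d p t)) d
    (eval (mem s) (regs s 0) (\<lambda>x. regs s (vs x)) t)"
  using compiles_correctly[of P t] assms unfolding compiles_correctly_def by blast

lemma poly_time_solvable_on_if_eval:
  fixes t :: "'v trm"
  assumes "\<And>x. x \<in> D \<Longrightarrow>
    eval (mem (ram_init (enc x))) (length (enc x)) (\<lambda>_. length (enc x)) t = of_bool (Q x)"
  shows "poly_time_solvable_on enc D Q"
proof -
  let ?c = "compile (\<lambda>_ :: 'v. 0) 1 0 t"
  let ?P = "?c @ [Const 0 0, Plus 0 0 1]"
  let ?q = "time_poly t + 2"
  have "halted ?P s \<and> regs s 0 = of_bool (Q x)"
    if x: "x \<in> D" and s: "s = ram_run ?P (poly ?q (length (enc x))) (ram_init (enc x))" for x s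
  proof -
    let ?t = "poly (time_poly t) (length (enc x))"
    have "evaluates_to ?P ?t (ram_init (enc x)) (length ?c) 1 (of_bool (Q x))"
      using compile_correct[of ?P 0 "\<lambda>_. 0" 1 t "ram_init (enc x)"] assms[OF x]
        code_at_self[of "[]" ?c]
      by (simp add: ram_init_def)
    then obtain s1 where run: "ram_run ?P ?t (ram_init (enc x)) = s1"
      and "pc s1 = length ?c" "regs s1 1 = of_bool (Q x)"
      by (rule evaluates_toE)
    moreover have "s = ram_run ?P 2 s1"
      using s by (simp add: poly_add flip: run ram_run_add)
    ultimately show ?thesis
      by (simp add: numeral_2_eq_2 ram_run_Suc nth_append halted_def)
  qed
  then show ?thesis
    unfolding poly_time_solvable_on_def Let_def by blast
qed

section \<open>Functions and predicates definable by terms\<close>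

lemma sum_of_bool_less_min: "(\<Sum>i<N. of_bool (i < a)) = min N (a :: nat)"
proof -
  have "{..<N} \<inter> {i. i < a} = {..<min N a}" by auto
  then show ?thesis by (simp del: lessThan_iff)
qed

context
  fixes enc :: "'i \<Rightarrow> bool list" and D :: "'i set"
begin

definition defines_function :: "'v trm \<Rightarrow> ('i \<Rightarrow> ('v \<Rightarrow> nat) \<Rightarrow> nat) \<Rightarrow> bool" where
  "defines_function t f \<longleftrightarrow>
     (\<forall>x\<in>D. \<forall>\<rho>. eval (mem (ram_init (enc x))) (length (enc x)) \<rho> t = f x \<rho>)"

definition definable :: "('i \<Rightarrow> ('v \<Rightarrow> nat) \<Rightarrow> nat) \<Rightarrow> bool" where
  "definable f \<longleftrightarrow> (\<exists>t. defines_function t f)"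

abbreviation expressible :: "('i \<Rightarrow> ('v \<Rightarrow> nat) \<Rightarrow> bool) \<Rightarrow> bool" where
  "expressible Q \<equiv> definable (\<lambda>x \<rho>. of_bool (Q x \<rho>))"

lemma definable_cong:
  assumes "definable f" "\<And>x \<rho>. x \<in> D \<Longrightarrow> f x \<rho> = g x \<rho>"
  shows "definable g"
  using assms by (simp add: definable_def defines_function_def)

lemma expressible_cong:
  assumes "expressible Q" "\<And>x \<rho>. x \<in> D \<Longrightarrow> Q x \<rho> \<longleftrightarrow> R x \<rho>"
  shows "expressible R"
  using assms by (simp add: definable_def defines_function_def)

lemma definable_const: "definable (\<lambda>x \<rho>. k)"
  unfolding definable_def defines_function_def by (rule exI[of _ "Cst k"]) simp

lemma definable_var: "definable (\<lambda>x \<rho>. \<rho> v)"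
  unfolding definable_def defines_function_def by (rule exI[of _ "Var v"]) simp

lemma definable_op:
  assumes "definable f" "definable g"
  shows "definable (\<lambda>x \<rho>. apply_op h (f x \<rho>) (g x \<rho>))"
proof -
  from assms obtain s t where "defines_function s f" "defines_function t g"
    unfolding definable_def by blast
  then have "defines_function (BinOp h s t) (\<lambda>x \<rho>. apply_op h (f x \<rho>) (g x \<rho>))"
    by (simp add: defines_function_def)
  then show ?thesis unfolding definable_def ..
qed

lemmas definable_add = definable_op[where h = Add, simplified]
lemmas definable_diff = definable_op[where h = Sub, simplified]

lemma definable_sum:
  assumes "definable (\<lambda>x \<rho>. f x \<rho> (\<rho> v))"
    and "\<And>x \<rho> i. x \<in> D \<Longrightarrow> f x (\<rho>(v := i)) = f x \<rho>"
  shows "definable (\<lambda>x \<rho>. \<Sum>i<length (enc x). f x \<rho> i)"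
proof -
  from assms(1) obtain t where "defines_function t (\<lambda>x \<rho>. f x \<rho> (\<rho> v))"
    unfolding definable_def ..
  then have "defines_function (Sum v t) (\<lambda>x \<rho>. \<Sum>i<length (enc x). f x \<rho> i)"
    using assms(2) by (simp add: defines_function_def)
  then show ?thesis unfolding definable_def ..
qed

lemma definable_finite_support:
  assumes "definable f"
  obtains A where "finite A" "\<And>x \<rho> v i. x \<in> D \<Longrightarrow> v \<notin> A \<Longrightarrow> f x (\<rho>(v := i)) = f x \<rho>"
proof -
  obtain t where t: "defines_function t f" using assms unfolding definable_def ..
  have "finite (set_trm t)" by (induction t) auto
  moreover have "f x (\<rho>(v := i)) = f x \<rho>" if "x \<in> D" "v \<notin> set_trm t" for x \<rho> v i
    using t that eval_fun_upd_fresh by (metis defines_function_def)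
  ultimately show thesis by (rule that)
qed

lemma expressible_cell:
  assumes "definable f"
  shows "expressible (\<lambda>x \<rho>. f x \<rho> < length (enc x) \<and> enc x ! f x \<rho>)"
proof -
  obtain t where "defines_function t f" using assms unfolding definable_def ..
  then have "defines_function (Cell t)
      (\<lambda>x \<rho>. of_bool (f x \<rho> < length (enc x) \<and> enc x ! f x \<rho>))"
    by (simp add: defines_function_def ram_init_def)
  then show ?thesis unfolding definable_def ..
qed

lemma expressible_not:
  assumes "expressible Q"
  shows "expressible (\<lambda>x \<rho>. \<not> Q x \<rho>)"
  using definable_diff[OF definable_const[of 1] assms] by (rule definable_cong) simp

lemma expressible_conj:
  assumes "expressible Q" "expressible R"
  shows "expressible (\<lambda>x \<rho>. Q x \<rho> \<and> R x \<rho>)"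
  using definable_diff[OF assms(1) expressible_not[OF assms(2)]] by (rule definable_cong) simp

lemma expressible_imp:
  assumes "expressible Q" "expressible R"
  shows "expressible (\<lambda>x \<rho>. Q x \<rho> \<longrightarrow> R x \<rho>)"
  using expressible_not[OF expressible_conj[OF assms(1) expressible_not[OF assms(2)]]]
  by (rule expressible_cong) simp

lemma expressible_iff:
  assumes "expressible Q" "expressible R"
  shows "expressible (\<lambda>x \<rho>. Q x \<rho> \<longleftrightarrow> R x \<rho>)"
  using expressible_conj[OF expressible_imp[OF assms] expressible_imp[OF assms(2,1)]]
  by (rule expressible_cong) auto

lemma expressible_less:
  assumes "definable f" "definable g"
  shows "expressible (\<lambda>x \<rho>. f x \<rho> < g x \<rho>)"
  using definable_diff[OF definable_const[of 1]
      definable_diff[OF definable_const[of 1] definable_diff[OF assms(2,1)]]]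
  by (rule definable_cong) auto

lemma expressible_ex_less:
  assumes "expressible (\<lambda>x \<rho>. Q x \<rho> (\<rho> v))"
    and "\<And>x \<rho> i. x \<in> D \<Longrightarrow> Q x (\<rho>(v := i)) = Q x \<rho>"
  shows "expressible (\<lambda>x \<rho>. \<exists>i<length (enc x). Q x \<rho> i)"
proof -
  have "definable (\<lambda>x \<rho>. \<Sum>i<length (enc x). of_bool (Q x \<rho> i))"
    by (rule definable_sum[where v = v]) (use assms in auto)
  from expressible_less[OF definable_const[of 0] this] show ?thesis
    by (rule definable_cong) (auto simp: card_gt_0_iff)
qed

lemma expressible_all_less:
  assumes "expressible (\<lambda>x \<rho>. Q x \<rho> (\<rho> v))"
    and "\<And>x \<rho> i. x \<in> D \<Longrightarrow> Q x (\<rho>(v := i)) = Q x \<rho>"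
  shows "expressible (\<lambda>x \<rho>. \<forall>i<length (enc x). Q x \<rho> i)"
proof -
  have "expressible (\<lambda>x \<rho>. \<exists>i<length (enc x). \<not> Q x \<rho> i)"
    by (rule expressible_ex_less[where v = v]) (use assms expressible_not in auto)
  from expressible_not[OF this] show ?thesis
    by (rule expressible_cong) auto
qed

lemma expressible_finite_Ball:
  assumes "finite A" "\<And>a. a \<in> A \<Longrightarrow> expressible (Q a)"
  shows "expressible (\<lambda>x \<rho>. \<forall>a\<in>A. Q a x \<rho>)"
  using assms
proof (induction A)
  case empty
  then show ?case using definable_const[of 1] by simp
next
  case (insert a A)
  then show ?case
    using expressible_conj[of "Q a" "\<lambda>x \<rho>. \<forall>a\<in>A. Q a x \<rho>"] by simp
qed

lemma expressible_finite_Bex: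
  assumes "finite A" "\<And>a. a \<in> A \<Longrightarrow> expressible (Q a)"
  shows "expressible (\<lambda>x \<rho>. \<exists>a\<in>A. Q a x \<rho>)"
  using expressible_not[OF expressible_finite_Ball[OF assms(1) expressible_not[OF assms(2)]]]
  by (rule expressible_cong) auto

lemma expressible_ex_valuation:
  assumes "finite A" "expressible Q"
  shows "expressible (\<lambda>x \<rho>.
    \<exists>\<sigma>. (\<forall>a\<in>A. \<sigma> a < length (enc x)) \<and> (\<forall>b. b \<notin> A \<longrightarrow> \<sigma> b = \<rho> b) \<and> Q x \<sigma>)"
  using assms(1)
proof (induction A)
  case empty
  have "\<sigma> = \<rho>" if "\<forall>b. \<sigma> b = \<rho> b" for \<sigma> \<rho> :: "'v \<Rightarrow> nat" using that by auto
  then show ?case using assms(2) by (auto cong: conj_cong elim!: expressible_cong)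
next
  case (insert a A)
  let ?ex = "\<lambda>A x \<rho>. \<exists>\<sigma>. (\<forall>a\<in>A. \<sigma> a < length (enc x)) \<and> (\<forall>b. b \<notin> A \<longrightarrow> \<sigma> b = \<rho> b) \<and> Q x \<sigma>"
  have "expressible (\<lambda>x \<rho>. \<exists>i<length (enc x). ?ex A x (\<rho>(a := i)))"
    by (rule expressible_ex_less[where v = a]) (use insert.IH in simp_all)
  then show ?case
  proof (rule expressible_cong)
    fix x \<rho>
    show "(\<exists>i<length (enc x). ?ex A x (\<rho>(a := i))) \<longleftrightarrow> ?ex (insert a A) x \<rho>"
    proof
      assume "\<exists>i<length (enc x). ?ex A x (\<rho>(a := i))"
      then obtain i \<sigma> where "i < length (enc x)" "\<forall>b\<in>A. \<sigma> b < length (enc x)"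
        and \<sigma>: "\<forall>b. b \<notin> A \<longrightarrow> \<sigma> b = (\<rho>(a := i)) b" "Q x \<sigma>"
        by blast
      moreover have "\<sigma> a = i" using \<sigma>(1) insert.hyps(2) by simp
      ultimately show "?ex (insert a A) x \<rho>" by (intro exI[of _ \<sigma>]) auto
    next
      assume "?ex (insert a A) x \<rho>"
      then obtain \<sigma> where "\<forall>b\<in>insert a A. \<sigma> b < length (enc x)"
          "\<forall>b. b \<notin> insert a A \<longrightarrow> \<sigma> b = \<rho> b" "Q x \<sigma>"
        by blast
      then show "\<exists>i<length (enc x). ?ex A x (\<rho>(a := i))"
        by (intro exI[of _ "\<sigma> a"] conjI exI[of _ \<sigma>]) auto
    qed
  qed
qed

text \<open>As all sums range over \<open>{..<length (enc x)}\<close>, the factors are cut off at this bound.\<close>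

lemma definable_mult_min:
  assumes "infinite (UNIV :: 'v set)"
    and "definable (f :: 'i \<Rightarrow> ('v \<Rightarrow> nat) \<Rightarrow> nat)" "definable g"
  shows "definable (\<lambda>x \<rho>. min (length (enc x)) (f x \<rho>) * min (length (enc x)) (g x \<rho>))"
proof -
  obtain A B where "finite A" "finite B"
    and f_upd: "\<And>x \<rho> v i. x \<in> D \<Longrightarrow> v \<notin> A \<Longrightarrow> f x (\<rho>(v := i)) = f x \<rho>"
    and g_upd: "\<And>x \<rho> v i. x \<in> D \<Longrightarrow> v \<notin> B \<Longrightarrow> g x (\<rho>(v := i)) = g x \<rho>"
    using assms(2,3) by (metis definable_finite_support)
  then obtain v w where fresh: "v \<notin> A" "v \<notin> B" "w \<notin> A" "w \<notin> B" and "v \<noteq> w"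
    using ex_new_if_finite[OF assms(1), of "A \<union> B"] ex_new_if_finite[OF assms(1)]
    by (metis UnCI finite_UnI finite_insert insertCI)
  have "definable (\<lambda>x \<rho>. \<Sum>j<length (enc x). of_bool (\<rho> v < f x \<rho> \<and> j < g x \<rho>))"
    by (rule definable_sum[where v = w],
        intro expressible_conj expressible_less definable_var assms)
      (use \<open>v \<noteq> w\<close> in \<open>simp add: f_upd g_upd fresh\<close>)
  then have "definable (\<lambda>x \<rho>.
      \<Sum>i<length (enc x). \<Sum>j<length (enc x). of_bool (i < f x \<rho> \<and> j < g x \<rho>))"
    by (rule definable_sum[where v = v]) (simp only: f_upd g_upd fresh not_False_eq_True)
  then show ?thesis
    by (rule definable_cong)
      (simp only: of_bool_conj sum_of_bool_less_min flip: sum_product)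
qed

end

lemma definable_subset:
  assumes "definable enc D f" "D' \<subseteq> D"
  shows "definable enc D' f"
  using assms unfolding definable_def defines_function_def by blast

lemma poly_time_solvable_on_if_expressible:
  assumes "expressible enc D (\<lambda>x (\<rho> :: 'v \<Rightarrow> nat). Q x)"
  shows "poly_time_solvable_on enc D Q"
proof -
  obtain t :: "'v trm" where "defines_function enc D t (\<lambda>x \<rho>. of_bool (Q x))"
    using assms unfolding definable_def ..
  then show ?thesis
    by (intro poly_time_solvable_on_if_eval[of _ _ t]) (simp add: defines_function_def)
qed

section \<open>Definability over encoded instances\<close>

lemma mult_add_less_mult:
  fixes i j m n :: nat
  assumes "i < m" "j < n"
  shows "i * n + j < m * n"
  using assms by (simp flip: div_less_iff_less_mult)

lemma nth_concat_map_map: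
  assumes "i < length xs" "j < length ys"
  shows "concat (map (\<lambda>x. map (f x) ys) xs) ! (i * length ys + j) = f (xs ! i) (ys ! j)"
proof -
  have "concat (map (\<lambda>x. map (f x) ys) xs) = map (\<lambda>(x, y). f x y) (List.product xs ys)"
    by (simp add: product_concat_map map_concat comp_def)
  moreover have "i * length ys + j < length xs * length ys"
    using assms by (rule mult_add_less_mult)
  moreover have "(i * length ys + j) div length ys = i"
    using assms(2) by (intro div_nat_eqI) simp_all
  ultimately show ?thesis using assms by (simp add: product_nth)
qed

lemma length_concat_map_map:
  "length (concat (map (\<lambda>x. map (f x) ys) xs)) = length xs * length ys"
  by (simp add: length_concat comp_def sum_list_triv)

context
  fixes G :: "nat pair_pre_digraph" and n :: nat
  assumes card_pverts: "card (pverts G) = n"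
begin

lemma lhom_encode_eq:
  "lhom_encode hs (G, L) =
     replicate n True @ [False] @
     concat (map (\<lambda>u. map (\<lambda>v. (u, v) \<in> parcs G) [0..<n]) [0..<n]) @
     concat (map (\<lambda>v. map (\<lambda>h. h \<in> L v) hs) [0..<n])"
  by (simp add: lhom_encode_def card_pverts)

lemma length_lhom_encode:
  "length (lhom_encode hs (G, L)) = n + 1 + (n * n + n * length hs)"
  by (simp add: lhom_encode_eq length_concat_map_map)

lemma lhom_encode_nth_unary:
  assumes "i \<le> n"
  shows "lhom_encode hs (G, L) ! i \<longleftrightarrow> i < n"
  using assms by (auto simp: lhom_encode_eq nth_append)

lemma lhom_encode_nth_adjacency:
  assumes "u < n" "v < n"
  shows "lhom_encode hs (G, L) ! (n + 1 + (u * n + v)) \<longleftrightarrow> (u, v) \<in> parcs G"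
  using nth_concat_map_map[of u "[0..<n]" v "[0..<n]" "\<lambda>u v. (u, v) \<in> parcs G"] assms
    mult_add_less_mult[OF assms]
  by (simp add: lhom_encode_eq nth_append length_concat_map_map)

lemma lhom_encode_nth_list:
  assumes "v < n" "j < length hs"
  shows "lhom_encode hs (G, L) ! (n + 1 + (n * n + (v * length hs + j))) \<longleftrightarrow> hs ! j \<in> L v"
  using nth_concat_map_map[of v "[0..<n]" j hs "\<lambda>v h. h \<in> L v"] assms
  by (simp add: lhom_encode_eq nth_append length_concat_map_map)

end

lemma lhom_instancesE:
  assumes "x \<in> lhom_instances H"
  obtains G L n where "x = (G, L)" "pair_graph G" "pverts G = {..<n}" "card (pverts G) = n"
  using assms by (auto simp: lhom_instances_def)

context
  fixes H :: "'a pair_pre_digraph" and hs :: "'a list"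
begin

abbreviation lhom_definable :: "('a lhom_input \<Rightarrow> ('v \<Rightarrow> nat) \<Rightarrow> nat) \<Rightarrow> bool" where
  "lhom_definable \<equiv> definable (lhom_encode hs) (lhom_instances H)"

abbreviation lhom_expressible :: "('a lhom_input \<Rightarrow> ('v \<Rightarrow> nat) \<Rightarrow> bool) \<Rightarrow> bool" where
  "lhom_expressible \<equiv> expressible (lhom_encode hs) (lhom_instances H)"

text \<open>The vertices are counted by the initial block of ones.\<close>

lemma definable_card_pverts:
  assumes "infinite (UNIV :: 'v set)"
  shows "lhom_definable (\<lambda>x (\<rho> :: 'v \<Rightarrow> nat). card (pverts (fst x)))"
proof -
  obtain v w :: 'v where "v \<noteq> w"
    using ex_new_if_finite[OF assms] by (metis finite.emptyI finite.insertI insertCI)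
  let ?N = "\<lambda>x. length (lhom_encode hs x)"
  let ?ones = "\<lambda>x i. \<forall>j<?N x. \<not> i < j \<longrightarrow> j < ?N x \<and> lhom_encode hs x ! j"
  have "lhom_expressible (\<lambda>x \<rho>. ?ones x (\<rho> v))"
    by (rule expressible_all_less[where v = w],
        intro expressible_imp expressible_not expressible_less expressible_cell definable_var)
      (use \<open>v \<noteq> w\<close> in simp)
  then have "lhom_definable (\<lambda>x (\<rho> :: 'v \<Rightarrow> nat). \<Sum>i<?N x. of_bool (?ones x i))"
    by (rule definable_sum) simp
  moreover have "(\<Sum>i<?N x. of_bool (?ones x i)) = card (pverts (fst x))"
    if x_instance: "x \<in> lhom_instances H" for x
  proof -
    from x_instance obtain G L n where x_eq: "x = (G, L)" and card_G: "card (pverts G) = n"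
      by (rule lhom_instancesE)
    have "n < ?N x"
      by (simp add: x_eq length_lhom_encode[OF card_G])
    then have "?ones x i \<longleftrightarrow> i < n" if "i < ?N x" for i
      using that lhom_encode_nth_unary[OF card_G, of _ hs L] unfolding x_eq
      by (metis less_le_trans less_or_eq_imp_le linorder_not_less)
    then have "(\<Sum>i<?N x. of_bool (?ones x i)) = (\<Sum>i<?N x. of_bool (i < n) :: nat)"
      by (intro sum.cong refl) (simp only: lessThan_iff)
    then show ?thesis
      using \<open>n < ?N x\<close> by (simp only: sum_of_bool_less_min) (simp add: x_eq card_G)
  qed
  ultimately show ?thesis by (rule definable_cong)
qed

lemma expressible_in_pverts:
  assumes "infinite (UNIV :: 'v set)"
  shows "lhom_expressible (\<lambda>x (\<rho> :: 'v \<Rightarrow> nat). \<rho> v \<in> pverts (fst x))"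
  using expressible_less[OF definable_var[of _ _ v] definable_card_pverts[OF assms]]
  by (rule expressible_cong) (metis fst_conv lessThan_iff lhom_instancesE)

lemma expressible_adjacent:
  assumes "infinite (UNIV :: 'v set)"
  shows "lhom_expressible (\<lambda>x (\<rho> :: 'v \<Rightarrow> nat). (\<rho> u, \<rho> v) \<in> parcs (fst x))"
proof -
  let ?N = "\<lambda>x. length (lhom_encode hs x)" and ?n = "\<lambda>x. card (pverts (fst x))"
  let ?addr = "\<lambda>x \<rho>. ?n x + 1 + (min (?N x) (\<rho> u) * min (?N x) (?n x) + \<rho> v)"
  have "lhom_expressible (\<lambda>x (\<rho> :: 'v \<Rightarrow> nat).
      (\<rho> u \<in> pverts (fst x) \<and> \<rho> v \<in> pverts (fst x)) \<and>
      (?addr x \<rho> < ?N x \<and> lhom_encode hs x ! ?addr x \<rho>))"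
    by (intro expressible_conj expressible_in_pverts expressible_cell definable_add
        definable_mult_min definable_const definable_var definable_card_pverts assms)
  then show ?thesis
  proof (rule expressible_cong)
    fix x and \<rho> :: "'v \<Rightarrow> nat" assume "x \<in> lhom_instances H"
    then obtain G L n where x_eq: "x = (G, L)" and "pair_graph G" and pverts_G: "pverts G = {..<n}"
        and card_G: "card (pverts G) = n"
      by (rule lhom_instancesE)
    interpret pair_graph G by fact
    have "?addr x \<rho> < ?N x \<and> (lhom_encode hs x ! ?addr x \<rho> \<longleftrightarrow> (\<rho> u, \<rho> v) \<in> parcs G)"
      if "\<rho> u < n" "\<rho> v < n"
      using that lhom_encode_nth_adjacency[OF card_G that, of hs L] mult_add_less_mult[OF that]
      by (simp add: x_eq card_G length_lhom_encode[OF card_G] min_def)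
    moreover have "\<rho> u < n \<and> \<rho> v < n" if "(\<rho> u, \<rho> v) \<in> parcs G"
      using that in_arcsD1 in_arcsD2 pverts_G by auto
    ultimately show "(\<rho> u \<in> pverts (fst x) \<and> \<rho> v \<in> pverts (fst x)) \<and>
        (?addr x \<rho> < ?N x \<and> lhom_encode hs x ! ?addr x \<rho>) \<longleftrightarrow>
        (\<rho> u, \<rho> v) \<in> parcs (fst x)"
      by (auto simp: x_eq pverts_G)
  qed
qed

lemma expressible_in_list:
  assumes "infinite (UNIV :: 'v set)" "h \<in> set hs"
  shows "lhom_expressible (\<lambda>x (\<rho> :: 'v \<Rightarrow> nat). \<rho> v \<in> pverts (fst x) \<and> h \<in> snd x (\<rho> v))"
proof -
  obtain j where j: "j < length hs" "h = hs ! j"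
    using assms(2) by (auto simp: in_set_conv_nth)
  let ?N = "\<lambda>x. length (lhom_encode hs x)" and ?n = "\<lambda>x. card (pverts (fst x))"
  let ?addr = "\<lambda>x \<rho>. ?n x + 1 + (min (?N x) (?n x) * min (?N x) (?n x) +
      (min (?N x) (\<rho> v) * min (?N x) (length hs) + j))"
  have "lhom_expressible (\<lambda>x (\<rho> :: 'v \<Rightarrow> nat). \<rho> v \<in> pverts (fst x) \<and>
      (?addr x \<rho> < ?N x \<and> lhom_encode hs x ! ?addr x \<rho>))"
    by (intro expressible_conj expressible_in_pverts expressible_cell definable_add
        definable_mult_min definable_const definable_var definable_card_pverts assms(1))
  then show ?thesis
  proof (rule expressible_cong)
    fix x and \<rho> :: "'v \<Rightarrow> nat" assume "x \<in> lhom_instances H"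
    then obtain G L n where x_eq: "x = (G, L)" and pverts_G: "pverts G = {..<n}"
        and card_G: "card (pverts G) = n"
      by (rule lhom_instancesE)
    have "?addr x \<rho> < ?N x \<and> (lhom_encode hs x ! ?addr x \<rho> \<longleftrightarrow> h \<in> L (\<rho> v))" if "\<rho> v < n"
    proof -
      have "length hs \<le> n * length hs" using that by simp
      then have "length hs \<le> ?N x" unfolding x_eq length_lhom_encode[OF card_G] by linarith
      moreover have "\<rho> v * length hs + j < n * length hs"
        using that j(1) by (rule mult_add_less_mult)
      ultimately show ?thesis
        using that lhom_encode_nth_list[OF card_G that j(1), of L]
        by (simp add: x_eq card_G j(2) length_lhom_encode[OF card_G] min_def)
    qed
    then show "\<rho> v \<in> pverts (fst x) \<and>
        (?addr x \<rho> < ?N x \<and> lhom_encode hs x ! ?addr x \<rho>) \<longleftrightarrow>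
        \<rho> v \<in> pverts (fst x) \<and> h \<in> snd x (\<rho> v)"
      by (auto simp: x_eq pverts_G)
  qed
qed

lemma expressible_Ball_pverts:
  assumes "infinite (UNIV :: 'v set)"
    and "lhom_expressible (\<lambda>x (\<rho> :: 'v \<Rightarrow> nat). Q x \<rho> (\<rho> v))"
    and "\<And>x \<rho> i. Q x (\<rho>(v := i)) = Q x \<rho>"
  shows "lhom_expressible (\<lambda>x \<rho>. \<forall>u\<in>pverts (fst x). Q x \<rho> u)"
proof -
  have "lhom_expressible (\<lambda>x \<rho>. \<forall>u<length (lhom_encode hs x). u \<in> pverts (fst x) \<longrightarrow> Q x \<rho> u)"
    by (rule expressible_all_less[where v = v])
      (use assms in \<open>auto intro: expressible_imp expressible_in_pverts\<close>)
  then show ?thesis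
  proof (rule expressible_cong)
    fix x \<rho> assume "x \<in> lhom_instances H"
    then obtain G L n where x_eq: "x = (G, L)" and pverts_G: "pverts G = {..<n}"
        and card_G: "card (pverts G) = n"
      by (rule lhom_instancesE)
    have "u < length (lhom_encode hs x)" if "u < n" for u
      using that by (simp add: x_eq length_lhom_encode[OF card_G])
    then show "(\<forall>u<length (lhom_encode hs x). u \<in> pverts (fst x) \<longrightarrow> Q x \<rho> u) \<longleftrightarrow>
        (\<forall>u\<in>pverts (fst x). Q x \<rho> u)"
      by (auto simp: x_eq pverts_G)
  qed
qed

text \<open>
  The representative of \<open>h\<close> is the value of the variable \<open>Inl h\<close>; the variables \<open>Inr i\<close> are for
  the vertices bound by quantifiers.
\<close>

lemma expressible_representatives:
  assumes "set hs = pverts H"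
  shows "lhom_expressible (\<lambda>x (\<rho> :: 'a + nat \<Rightarrow> nat).
    representatives (fst x) H (snd x) (\<lambda>h. \<rho> (Inl h)))"
proof -
  have infinite_vars: "infinite (UNIV :: ('a + nat) set)" by simp
  have finite_H: "finite (pverts H)" using assms by (metis finite_set)
  have arcs: "lhom_expressible (\<lambda>x \<rho>. \<forall>h\<in>pverts H. \<forall>h'\<in>pverts H.
      (\<rho> (Inl h), \<rho> (Inl h' :: 'a + nat)) \<in> parcs (fst x) \<longrightarrow> (h, h') \<in> parcs H)"
    by (intro expressible_finite_Ball finite_H expressible_imp expressible_adjacent
        definable_const infinite_vars)
  have twins: "lhom_expressible (\<lambda>x \<rho>. twins (fst x) (\<rho> (Inr 0)) (\<rho> (Inl h :: 'a + nat)))" for h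
    unfolding twins_def
    by (rule expressible_Ball_pverts[OF infinite_vars, where v = "Inr 1"])
      (simp_all add: expressible_iff expressible_adjacent infinite_vars)
  have "lhom_expressible (\<lambda>x \<rho>. \<exists>h\<in>pverts H.
      (\<rho> (Inr 0) \<in> pverts (fst x) \<and> h \<in> snd x (\<rho> (Inr 0))) \<and>
      twins (fst x) (\<rho> (Inr 0)) (\<rho> (Inl h :: 'a + nat)))"
    by (intro expressible_finite_Bex finite_H expressible_conj[OF expressible_in_list twins]
        infinite_vars)
      (simp add: assms)
  then have "lhom_expressible (\<lambda>x \<rho>. \<forall>u\<in>pverts (fst x). \<exists>h\<in>pverts H.
      (u \<in> pverts (fst x) \<and> h \<in> snd x u) \<and> twins (fst x) u (\<rho> (Inl h :: 'a + nat)))"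
    by (rule expressible_Ball_pverts[OF infinite_vars]) simp
  from expressible_conj[OF arcs this] show ?thesis
    by (rule expressible_cong) (simp add: representatives_def)
qed

lemma expressible_ex_representatives:
  assumes "set hs = pverts H"
  shows "lhom_expressible (\<lambda>x (\<rho> :: 'a + nat \<Rightarrow> nat).
    \<exists>r. (\<forall>h\<in>pverts H. r h < length (lhom_encode hs x)) \<and> representatives (fst x) H (snd x) r)"
proof -
  let ?N = "\<lambda>x. length (lhom_encode hs x)"
  let ?A = "Inl ` pverts H :: ('a + nat) set"
  have "finite ?A" using assms by (metis finite_imageI finite_set)
  note expressible_ex_valuation[OF this expressible_representatives[OF assms]]
  then show ?thesis
  proof (rule expressible_cong, safe)
    fix x and \<sigma> :: "'a + nat \<Rightarrow> nat"
    assume "\<forall>a\<in>?A. \<sigma> a < ?N x" "representatives (fst x) H (snd x) (\<lambda>h. \<sigma> (Inl h))"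
    then show "\<exists>r. (\<forall>h\<in>pverts H. r h < ?N x) \<and> representatives (fst x) H (snd x) r"
      by (intro exI[of _ "\<lambda>h. \<sigma> (Inl h)"]) simp
  next
    fix x r and \<rho> :: "'a + nat \<Rightarrow> nat"
    assume r: "\<forall>h\<in>pverts H. r h < ?N x" "representatives (fst x) H (snd x) r"
    define \<sigma> where "\<sigma> b = (if b \<in> ?A then r (projl b) else \<rho> b)" for b
    have "representatives (fst x) H (snd x) (\<lambda>h. \<sigma> (Inl h))"
      using r(2) by (subst representatives_cong[where r' = r]) (auto simp: \<sigma>_def)
    then show "\<exists>\<sigma>. (\<forall>a\<in>?A. \<sigma> a < ?N x) \<and> (\<forall>b. b \<notin> ?A \<longrightarrow> \<sigma> b = \<rho> b) \<and>
        representatives (fst x) H (snd x) (\<lambda>h. \<sigma> (Inl h))"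
      using r(1) by (intro exI[of _ \<sigma>]) (auto simp: \<sigma>_def)
  qed
qed

end

lemma lhom_yes_iff_representatives:
  assumes "triangle_free H" "(G, L) \<in> lhom_instances H" "graph_diameter G \<le> 2"
  shows "lhom_yes H (G, L) \<longleftrightarrow>
    (\<exists>r. (\<forall>h\<in>pverts H. r h < length (lhom_encode hs (G, L))) \<and> representatives G H L r)"
proof -
  obtain n where "pair_graph G" and pverts_G: "pverts G = {..<n}" "card (pverts G) = n"
    using assms(2) by (auto elim: lhom_instancesE)
  interpret pair_graph G by fact
  have "pverts G \<subset> {..<length (lhom_encode hs (G, L))}"
    unfolding pverts_G(1)
    by (simp add: length_lhom_encode[OF pverts_G(2)] lessThan_strict_subset_iff)
  from homomorphism_iff_representatives[OF assms(1,3) this] show ?thesis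
    by (simp add: lhom_yes_def)
qed

theorem theorem4:
  fixes H :: "'a pair_pre_digraph" and hs :: "'a list"
  assumes "pair_graph H"
    and "triangle_free H"
    and "distinct hs" and "set hs = pverts H"
  shows "poly_time_solvable_on (lhom_encode hs)
           {(G, L). (G, L) \<in> lhom_instances H \<and> graph_diameter G \<le> 2}
           (lhom_yes H)"
proof (rule poly_time_solvable_on_if_expressible)
  let ?D = "{(G, L). (G, L) \<in> lhom_instances H \<and> graph_diameter G \<le> 2}"
  have "expressible (lhom_encode hs) ?D (\<lambda>x (\<rho> :: 'a + nat \<Rightarrow> nat).
      \<exists>r. (\<forall>h\<in>pverts H. r h < length (lhom_encode hs x)) \<and> representatives (fst x) H (snd x) r)"
    using expressible_ex_representatives[OF assms(4)] by (rule definable_subset) auto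
  then show "expressible (lhom_encode hs) ?D (\<lambda>x (\<rho> :: 'a + nat \<Rightarrow> nat). lhom_yes H x)"
    by (rule expressible_cong)
      (clarsimp simp: lhom_yes_iff_representatives[OF assms(2), where hs = hs])
qed

end
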